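(* Let $T\subset\mathbb{R}^d$ be a (non-degenerate) simplicial boundary element of $\Omega_h$, let $\{\psi_k\}_{k=1}^D$ be a basis of $\mathbb{P}_p$, let $\boldsymbol{\varphi}=[\psi_1,\ldots,\psi_D]^T$, let $M\in\mathbb{R}^{D\times D}$ be the mass matrix $[M]_{jk}=\int_T\psi_j\psi_k\,\mathrm{d}\mathbf{x}$, and let $u_h(\mathbf{x})=\boldsymbol{\varphi}^T(\mathbf{x})\hat{\mathbf{u}}$ with $\hat{\mathbf{u}}\in\mathbb{R}^D$ be the internal polynomial of $T$. Let $\tilde{\mathbf{x}}\in\partial\Omega_h$ be a point of the computational boundary, let $\bar{\mathbf{x}}=\mathcal{M}(\tilde{\mathbf{x}})\in\partial\Omega$ be the corresponding point of the physical boundary, and let $u_{\mathcal{D}}(\bar{\mathbf{x}})\in\mathbb{R}$ be the Dirichlet datum at $\bar{\mathbf{x}}$. Let $\hat{\mathbf{v}}\in\mathbb{R}^D$ be the coefficients given by the single-constraint ROD-$L^2$ method, i.e. $(\hat{\mathbf{v}},\lambda)\in\mathbb{R}^D\times\mathbb{R}$ solves $$\begin{bmatrix}M & \boldsymbol{\varphi}(\bar{\mathbf{x}}) \\ \boldsymbol{\varphi}^T(\bar{\mathbf{x}}) & 0 \end{bmatrix}\begin{bmatrix}\hat{\mathbf{v}} \\ \lambda \end{bmatrix} = \begin{bmatrix}M\hat{\mathbf{u}} \\ u_{\mathcal{D}}(\bar{\mathbf{x}}) \end{bmatrix},$$ and let $v_h(\mathbf{x})=\boldsymbol{\varphi}^T(\mathbf{x})\hat{\mathbf{v}}$.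 Then the boundary value $v_h(\tilde{\mathbf{x}})$ imposed by the method is given by the polynomial correction $$v_h(\tilde{\mathbf{x}}) = [\boldsymbol{\varphi}(\tilde{\mathbf{x}}) - \alpha\, \boldsymbol{\varphi}(\bar{\mathbf{x}})]^T \hat{\mathbf{u}} + \alpha\, u_{\mathcal{D}}(\bar{\mathbf{x}}),\qquad \alpha = \frac{\boldsymbol{\varphi}^T(\tilde{\mathbf{x}}) M^{-1}\boldsymbol{\varphi}(\bar{\mathbf{x}})}{\boldsymbol{\varphi}^T(\bar{\mathbf{x}}) M^{-1}\boldsymbol{\varphi}(\bar{\mathbf{x}})}.$$
   Context: $\mathbb{P}_p$ is the space of real polynomials in $d$ variables of total degree at most $p$, and $D=\prod_{\ell=1}^d (p+\ell)/\ell$ is its dimension. $\Omega\subset\mathbb{R}^d$ is the physical domain with (curved) boundary $\partial\Omega$; $\Omega_h$ is its approximation by a union of non-overlapping simplices, with boundary $\partial\Omega_h$; $\mathcal{M}$ is a map associating to each $\tilde{\mathbf{x}}\in\partial\Omega_h$ a unique point $\bar{\mathbf{x}}=\mathcal{M}(\tilde{\mathbf{x}})\in\partial\Omega$. Polynomials and basis functions are evaluated at any point of $\mathbb{R}^d$ (in particular at $\bar{\mathbf{x}}$, which need not lie in $T$). The single-constraint ROD-$L^2$ (Reconstruction for Off-site Data, $L^2$-norm) method builds, for each pair $(\tilde{\mathbf{x}},\bar{\mathbf{x}})$, a modified polynomial $v_h=\boldsymbol{\varphi}^T\hat{\mathbf{v}}$ by minimizing $\frac12\int_T(v_h-u_h)^2\,\mathrm{d}\mathbf{x}$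 subject to the single constraint $v_h(\bar{\mathbf{x}})=u_{\mathcal{D}}(\bar{\mathbf{x}})$. With the Lagrange multiplier $\lambda$, the functional is $\mathcal{J}(\hat{\mathbf{v}},\lambda)=\frac12\int_T(v_h(\mathbf{x})-u_h(\mathbf{x}))^2\,\mathrm{d}\mathbf{x}+\lambda(v_h(\bar{\mathbf{x}})-u_{\mathcal{D}}(\bar{\mathbf{x}}))$, and its optimality conditions $\int_T(v_h-u_h)\boldsymbol{\varphi}\,\mathrm{d}\mathbf{x}+\lambda\boldsymbol{\varphi}(\bar{\mathbf{x}})=0$, $\boldsymbol{\varphi}^T(\bar{\mathbf{x}})\hat{\mathbf{v}}-u_{\mathcal{D}}(\bar{\mathbf{x}})=0$ are the linear system in the claim. The method then uses $v_h(\tilde{\mathbf{x}})=\boldsymbol{\varphi}^T(\tilde{\mathbf{x}})\hat{\mathbf{v}}$ as the boundary value at $\tilde{\mathbf{x}}$. *)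

theory Defs
  imports "HOL-Analysis.Analysis" "HOL-Library.Function_Algebras"
begin

text \<open>Real-valued functions as a real vector space, which supplies \<open>span\<close> and \<open>independent\<close>.\<close>

definition fscale :: "real \<Rightarrow> ('a \<Rightarrow> real) \<Rightarrow> 'a \<Rightarrow> real"
  where "fscale c f = (\<lambda>x. c * f x)"

global_interpretation fun_space: vector_space "fscale :: real \<Rightarrow> ('a \<Rightarrow> real) \<Rightarrow> 'a \<Rightarrow> real"
  by standard (auto simp: fscale_def fun_eq_iff algebra_simps)

definition monomial_fun :: "('d::finite \<Rightarrow> nat) \<Rightarrow> real ^ 'd \<Rightarrow> real"
  where "monomial_fun a = (\<lambda>x. \<Prod>i\<in>UNIV. (x $ i) ^ a i)"

text \<open>Polynomials are identified with polynomial functions on the whole space, so that they can be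
  evaluated outside the element.\<close>

definition poly_space :: "nat \<Rightarrow> (real ^ 'd::finite \<Rightarrow> real) set"
  where "poly_space p = fun_space.span {monomial_fun a | a. (\<Sum>i\<in>UNIV. a i) \<le> p}"

definition indexed_basis :: "('n \<Rightarrow> 'a \<Rightarrow> real) \<Rightarrow> ('a \<Rightarrow> real) set \<Rightarrow> bool"
  where "indexed_basis \<psi> V \<longleftrightarrow>
    inj \<psi> \<and> fun_space.independent (range \<psi>) \<and> fun_space.span (range \<psi>) = V"

definition basis_vec :: "('n::finite \<Rightarrow> 'a \<Rightarrow> real) \<Rightarrow> 'a \<Rightarrow> real ^ 'n"
  where "basis_vec \<psi> x = (\<chi> k. \<psi> k x)"

definition mass_matrix ::
    "(real ^ 'd::finite) set \<Rightarrow> ('n::finite \<Rightarrow> real ^ 'd \<Rightarrow> real) \<Rightarrow> real ^ 'n ^ 'n"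
  where "mass_matrix T \<psi> = (\<chi> j k. integral T (\<lambda>x. \<psi> j x * \<psi> k x))"

text \<open>The meshes below consist of full-dimensional simplices, which is what makes each of them
  non-degenerate; non-overlapping means that only boundary points are shared.\<close>

definition simplicial_mesh :: "(real ^ 'd::finite) set set \<Rightarrow> bool"
  where "simplicial_mesh \<T> \<longleftrightarrow>
    (\<forall>S\<in>\<T>. int CARD('d) simplex S) \<and>
    pairwise (\<lambda>S S'. interior S \<inter> interior S' = {}) \<T>"

definition boundary_element :: "(real ^ 'd::finite) set set \<Rightarrow> (real ^ 'd) set \<Rightarrow> bool"
  where "boundary_element \<T> T \<longleftrightarrow> T \<in> \<T> \<and> T \<inter> frontier (\<Union>\<T>) \<noteq> {}"

text \<open>The matrix \<open>[A, b; b\<^sup>T, 0]\<close> and the vector \<open>[w; s]\<close>; the index type \<open>'n + 1\<close> appends one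
  index (type \<open>1\<close> has a single element) to \<open>'n\<close>.\<close>

definition bordered_matrix :: "real ^ 'n ^ 'n \<Rightarrow> real ^ 'n \<Rightarrow> real ^ ('n::finite + 1) ^ ('n + 1)"
  where "bordered_matrix A b = (\<chi> i j. case (i, j) of
      (Inl r, Inl s) \<Rightarrow> A $ r $ s
    | (Inl r, Inr _) \<Rightarrow> b $ r
    | (Inr _, Inl s) \<Rightarrow> b $ s
    | (Inr _, Inr _) \<Rightarrow> 0)"

definition bordered_vec :: "real ^ 'n \<Rightarrow> real \<Rightarrow> real ^ ('n::finite + 1)"
  where "bordered_vec w s = (\<chi> i. case i of Inl r \<Rightarrow> w $ r | Inr _ \<Rightarrow> s)"

end

theory Submission
  imports Defs
begin

text \<open>
  Eliminating the multiplier from the saddle-point system proves the formula. Write \<open>b\<close> for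
  \<open>\<phi>(xb)\<close> and \<open>g\<close> for \<open>M\<inverse> b\<close>. The first block row says \<open>v = u - \<lambda> g\<close>; inserting this into the
  constraint \<open>b \<bullet> v = u\<^sub>D\<close> gives \<open>\<lambda> (b \<bullet> g) = b \<bullet> u - u\<^sub>D\<close>, and testing \<open>v\<close> against any vector \<open>a\<close>,
  in particular against \<open>\<phi>(xt)\<close>, gives the correction with \<open>\<alpha> = (a \<bullet> g) / (b \<bullet> g)\<close>
  (lemma \<open>bordered_system_solution\<close>).

  This elimination is legitimate because \<open>M\<close> is invertible and \<open>b \<bullet> g \<noteq> 0\<close>. Both follow from
  positive definiteness of the mass matrix: \<open>w \<bullet> M w\<close> is the integral over \<open>T\<close> of the square of the
  polynomial with coefficients \<open>w\<close>, and if it vanishes then that polynomial vanishes on the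
  interior of \<open>T\<close>, which is nonempty for a full-dimensional simplex, hence everywhere, so that \<open>w = 0\<close>
  by independence of the basis (lemma \<open>mass_matrix_pos_def\<close>). Moreover \<open>b \<noteq> 0\<close>, wherever \<open>xb\<close>
  lies, since a point at which all basis functions vanish would be a zero of the constant
  polynomial 1 (lemma \<open>basis_vec_poly_space_nonzero\<close>). Consequently
  \<open>b \<bullet> g = g \<bullet> M g > 0\<close>.
\<close>

section \<open>Polynomial functions on open sets and on simplices\<close>

text \<open>
  The restriction of a polynomial function to a line through an interior point of its zero set is
  a univariate polynomial with infinitely many roots.
\<close>

lemma real_polynomial_function_zero_on_interior:
  fixes q :: "'a::real_normed_vector \<Rightarrow> real"
  assumes q: "real_polynomial_function q"
    and c: "c \<in> interior S"
    and zero: "\<And>x. x \<in> S \<Longrightarrow> q x = 0"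
  shows "q x = 0"
proof -
  define line where "line = (\<lambda>t::real. c + t *\<^sub>R (x - c))"
  have "polynomial_function line"
    unfolding line_def by (intro polynomial_function_add polynomial_function_const
        polynomial_function_bounded_linear bounded_linear_scaleR_left)
  then have "real_polynomial_function (q \<circ> line)"
    using q by (rule real_polynomial_function_compose)
  then obtain a n where sum: "q \<circ> line = (\<lambda>t. \<Sum>i\<le>n. a i * t ^ i)"
    using real_polynomial_function_iff_sum by blast
  have "isCont line 0"
    unfolding line_def by (intro continuous_intros)
  then have "(line \<longlongrightarrow> c) (nhds 0)"
    using tendsto_at_iff_tendsto_nhds[of line 0] by (simp add: line_def isCont_def)
  then have "\<forall>\<^sub>F t in nhds 0. line t \<in> interior S"
    using c by (auto intro: topological_tendstoD)
  then obtain e where e: "e > 0" "\<And>t. dist t 0 < e \<Longrightarrow> line t \<in> interior S"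
    unfolding eventually_nhds_metric by blast
  have "{0<..<e} \<subseteq> {t. (\<Sum>i\<le>n. a i * t ^ i) = 0}"
  proof
    fix t assume "t \<in> {0<..<e}"
    then have "line t \<in> S"
      using e(2)[of t] interior_subset by (auto simp: dist_real_def)
    then have "(q \<circ> line) t = 0"
      by (simp add: zero)
    then show "t \<in> {t. (\<Sum>i\<le>n. a i * t ^ i) = 0}"
      by (simp add: sum)
  qed
  then have "infinite {t. (\<Sum>i\<le>n. a i * t ^ i) = 0}"
    using e(1) infinite_Ioo finite_subset by blast
  then have "\<forall>i\<le>n. a i = 0"
    using polyfun_finite_roots by blast
  then have "(q \<circ> line) 1 = 0"
    unfolding sum by simp
  then show ?thesis
    by (simp add: line_def)
qed

lemma interior_simplex_nonempty_full_dim: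
  fixes T :: "'a::euclidean_space set"
  assumes "int DIM('a) simplex T"
  shows "interior T \<noteq> {}"
proof -
  have aff: "aff_dim T = int DIM('a)"
    using assms by (rule aff_dim_simplex)
  then have "affine hull T = UNIV"
    by (simp add: aff_dim_eq_full)
  moreover have "T \<noteq> {}"
    using aff by auto
  ultimately show ?thesis
    using convex_simplex[OF assms] rel_interior_interior rel_interior_eq_empty by metis
qed

lemma continuous_on_compact_integrable_on:
  fixes f :: "'a::euclidean_space \<Rightarrow> real"
  assumes "compact S" "continuous_on S f"
  shows "f integrable_on S"
  using borel_integrable_compact[OF assms] set_borel_integral_eq_integral(1)
  unfolding set_integrable_def by blast

text \<open>
  Vanishing of the integral is passed to a box in the interior of \<open>S\<close>, where continuity turns it
  into pointwise vanishing; the interior of the box then forces \<open>q\<close> to vanish everywhere.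
\<close>

lemma real_polynomial_function_integral_square_pos:
  fixes q :: "'a::euclidean_space \<Rightarrow> real"
  assumes q: "real_polynomial_function q"
    and S: "compact S" "interior S \<noteq> {}"
    and x: "q x \<noteq> 0"
  shows "integral S (\<lambda>x. q x * q x) > 0"
proof (rule ccontr)
  assume "\<not> integral S (\<lambda>x. q x * q x) > 0"
  have cont: "continuous_on A (\<lambda>x. q x * q x)" for A
    using q by (intro continuous_on_mult continuous_on_polymonial_function)
      (simp_all add: real_polynomial_function_eq)
  obtain c where "c \<in> interior S"
    using S(2) by blast
  then obtain a b where ab: "c \<in> box a b" "cbox a b \<subseteq> interior S"
    by (rule open_contains_cbox[THEN iffD1, OF open_interior, rule_format, THEN bexE]) auto
  have intS: "(\<lambda>x. q x * q x) integrable_on S"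
    and intab: "(\<lambda>x. q x * q x) integrable_on cbox a b"
    using S(1) cont by (auto intro: continuous_on_compact_integrable_on)
  have "integral (cbox a b) (\<lambda>x. q x * q x) \<le> integral S (\<lambda>x. q x * q x)"
    using ab(2) interior_subset by (intro integral_subset_le intS intab) auto
  moreover have "integral (cbox a b) (\<lambda>x. q x * q x) \<ge> 0"
    by (intro integral_nonneg intab) auto
  ultimately have "integral (cbox a b) (\<lambda>x. q x * q x) = 0"
    using \<open>\<not> integral S (\<lambda>x. q x * q x) > 0\<close> by linarith
  then have int0: "((\<lambda>x. q x * q x) has_integral 0) (cbox a b)"
    using intab by (metis integrable_integral)
  have "q y = 0" if "y \<in> cbox a b" for y
    using has_integral_0_cbox_imp_0[OF cont _ int0 _ that] ab(1) by auto
  moreover have "c \<in> interior (cbox a b)"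
    using ab(1) by simp
  ultimately show False
    using real_polynomial_function_zero_on_interior[OF q] x by blast
qed

section \<open>Bases of polynomial spaces and their mass matrices\<close>

lemma poly_space_real_polynomial_function:
  fixes q :: "real ^ 'd::finite \<Rightarrow> real"
  assumes "q \<in> poly_space p"
  shows "real_polynomial_function q"
  using assms unfolding poly_space_def
proof (induction rule: fun_space.span_induct_alt)
  case base
  show ?case
    by (auto simp: zero_fun_def)
next
  case (step c f g)
  then obtain a where f: "f = monomial_fun a"
    by blast
  have "real_polynomial_function f"
    unfolding f monomial_fun_def
    by (intro real_polynomial_function_prod real_polynomial_function_power
        real_polynomial_function.intros(1) bounded_linear_vec_nth finite)
  then show ?case
    using step(2) unfolding fscale_def plus_fun_def
    by (intro real_polynomial_function.intros(2-4))
qed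

lemma indexed_basis_mem:
  assumes "indexed_basis \<psi> V"
  shows "\<psi> k \<in> V"
  using assms fun_space.span_base[of "\<psi> k" "range \<psi>"] by (auto simp: indexed_basis_def)

lemma indexed_basis_combination_zero:
  fixes \<psi> :: "'n::finite \<Rightarrow> 'a \<Rightarrow> real"
  assumes basis: "indexed_basis \<psi> V"
    and zero: "\<And>x. basis_vec \<psi> x \<bullet> w = 0"
  shows "w = 0"
proof -
  have inj: "inj \<psi>" and indep: "fun_space.independent (range \<psi>)"
    using basis by (auto simp: indexed_basis_def)
  have apply_sum: "(\<Sum>k\<in>K. h k) x = (\<Sum>k\<in>K. h k x)" for K and h :: "'n \<Rightarrow> 'a \<Rightarrow> real" and x
    by (induction K rule: infinite_finite_induct) auto
  \<comment> \<open>Independence speaks of the set \<open>range \<psi>\<close>, so coefficients are attached to its elements.\<close>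
  have "(\<Sum>f\<in>range \<psi>. fscale (w $ inv \<psi> f) f) = (\<Sum>k\<in>UNIV. fscale (w $ k) (\<psi> k))"
    using inj by (simp add: sum.reindex)
  also have "\<dots> = 0"
  proof
    fix x
    show "(\<Sum>k\<in>UNIV. fscale (w $ k) (\<psi> k)) x = 0 x"
      using zero[of x] by (simp add: apply_sum fscale_def basis_vec_def inner_vec_def mult.commute)
  qed
  finally have "w $ inv \<psi> (\<psi> k) = 0" for k
    using fun_space.independentD[OF indep, of "range \<psi>" "\<lambda>f. w $ inv \<psi> f" "\<psi> k"] by simp
  then show ?thesis
    using inj by (simp add: vec_eq_iff)
qed

text \<open>A common zero of all basis functions would be a zero of the constant polynomial 1.\<close>

lemma basis_vec_poly_space_nonzero:
  fixes \<psi> :: "'n::finite \<Rightarrow> real ^ 'd::finite \<Rightarrow> real"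
  assumes "indexed_basis \<psi> (poly_space p)"
  shows "basis_vec \<psi> x \<noteq> 0"
proof
  assume "basis_vec \<psi> x = 0"
  then have vanish: "\<psi> k x = 0" for k
    by (simp add: basis_vec_def vec_eq_iff)
  have "q x = 0" if "q \<in> fun_space.span (range \<psi>)" for q
    using that by (induction rule: fun_space.span_induct_alt) (auto simp: fscale_def vanish)
  moreover have "monomial_fun (\<lambda>_. 0) \<in> fun_space.span (range \<psi>)"
    using assms by (auto simp: indexed_basis_def poly_space_def intro!: fun_space.span_base)
  ultimately have "monomial_fun (\<lambda>_. 0) x = 0"
    by blast
  then show False
    by (simp add: monomial_fun_def)
qed

lemma mass_matrix_quadratic_form:
  fixes \<psi> :: "'n::finite \<Rightarrow> real ^ 'd::finite \<Rightarrow> real"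
  assumes poly: "\<And>k. real_polynomial_function (\<psi> k)" and T: "compact T"
  shows "w \<bullet> (mass_matrix T \<psi> *v w) =
    integral T (\<lambda>x. (basis_vec \<psi> x \<bullet> w) * (basis_vec \<psi> x \<bullet> w))"
proof -
  have cont: "continuous_on T (\<psi> k)" for k
    using poly[of k] continuous_on_polymonial_function[of "\<psi> k" T]
    by (simp add: real_polynomial_function_eq)
  have int: "(\<lambda>x. w $ j * (\<psi> j x * \<psi> k x * w $ k)) integrable_on T" for j k
    by (intro continuous_on_compact_integrable_on T continuous_intros cont)
  have "integral T (\<lambda>x. (basis_vec \<psi> x \<bullet> w) * (basis_vec \<psi> x \<bullet> w)) =
      integral T (\<lambda>x. \<Sum>j\<in>UNIV. \<Sum>k\<in>UNIV. w $ j * (\<psi> j x * \<psi> k x * w $ k))"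
    by (simp add: basis_vec_def inner_vec_def sum_product mult_ac)
  also have "\<dots> = (\<Sum>j\<in>UNIV. \<Sum>k\<in>UNIV. integral T (\<lambda>x. w $ j * (\<psi> j x * \<psi> k x * w $ k)))"
    by (simp add: integral_sum integrable_sum int)
  also have "\<dots> = w \<bullet> (mass_matrix T \<psi> *v w)"
    by (simp add: inner_vec_def matrix_vector_mult_def mass_matrix_def sum_distrib_left)
  finally show ?thesis ..
qed

lemma mass_matrix_pos_def:
  fixes \<psi> :: "'n::finite \<Rightarrow> real ^ 'd::finite \<Rightarrow> real"
  assumes basis: "indexed_basis \<psi> (poly_space p)"
    and T: "compact T" "interior T \<noteq> {}"
    and w: "w \<noteq> 0"
  shows "w \<bullet> (mass_matrix T \<psi> *v w) > 0"
proof -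
  have poly: "real_polynomial_function (\<psi> k)" for k
    using basis by (intro poly_space_real_polynomial_function indexed_basis_mem)
  obtain x where x: "basis_vec \<psi> x \<bullet> w \<noteq> 0"
    using indexed_basis_combination_zero[OF basis] w by blast
  have "real_polynomial_function (\<lambda>x. basis_vec \<psi> x \<bullet> w)"
    by (auto simp: basis_vec_def inner_vec_def
        intro!: real_polynomial_function_sum real_polynomial_function.intros(4) poly)
  then show ?thesis
    using real_polynomial_function_integral_square_pos[where q = "\<lambda>x. basis_vec \<psi> x \<bullet> w", OF _ T x]
    by (simp add: mass_matrix_quadratic_form[OF poly T(1)])
qed

section \<open>Bordered linear systems\<close>

lemma bordered_system_iff:
  fixes A :: "real ^ 'n::finite ^ 'n"
  shows "bordered_matrix A b *v bordered_vec v l = bordered_vec w s \<longleftrightarrow>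
    A *v v + l *\<^sub>R b = w \<and> b \<bullet> v = s"
proof -
  have split: "(\<Sum>j\<in>UNIV. f j) = (\<Sum>r\<in>UNIV. f (Inl r)) + f (Inr 1)"
    for f :: "'n + 1 \<Rightarrow> real"
    unfolding UNIV_Plus_UNIV[symmetric] by (simp add: sum.Plus del: UNIV_Plus_UNIV)
  have all: "(\<forall>i. P i) \<longleftrightarrow> (\<forall>r. P (Inl r)) \<and> P (Inr 1)" for P :: "'n + 1 \<Rightarrow> bool"
    by (metis num1_eq1 sum.exhaust)
  show ?thesis
    by (simp add: vec_eq_iff all matrix_vector_mult_def split bordered_matrix_def bordered_vec_def
        inner_vec_def mult.commute)
qed

lemma matrix_inv:
  fixes A :: "'a::semiring_1 ^ 'n ^ 'm"
  assumes "invertible A"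
  shows "A ** matrix_inv A = mat 1" "matrix_inv A ** A = mat 1"
  using someI_ex[OF assms[unfolded invertible_def]] by (simp_all add: matrix_inv_def)

text \<open>
  Any test vector \<open>a\<close> sees the solution of the bordered system through a correction with the same
  multiplier, which the last row determines.
\<close>

lemma bordered_system_solution:
  fixes A :: "real ^ 'n::finite ^ 'n" and a b :: "real ^ 'n"
  assumes inv: "invertible A"
    and schur: "b \<bullet> (matrix_inv A *v b) \<noteq> 0"
    and sys: "bordered_matrix A b *v bordered_vec v l = bordered_vec (A *v u) s"
    and \<alpha>: "\<alpha> = (a \<bullet> (matrix_inv A *v b)) / (b \<bullet> (matrix_inv A *v b))"
  shows "a \<bullet> v = (a - \<alpha> *\<^sub>R b) \<bullet> u + \<alpha> * s"
proof -
  define g where "g = matrix_inv A *v b"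
  have cancel: "matrix_inv A *v (A *v x) = x" for x
    using inv by (simp add: matrix_vector_mul_assoc matrix_inv(2))
  have "A *v v + l *\<^sub>R b = A *v u" and con: "b \<bullet> v = s"
    using sys by (auto simp: bordered_system_iff)
  then have "matrix_inv A *v (A *v v + l *\<^sub>R b) = u"
    by (simp add: cancel)
  then have v: "v = u - l *\<^sub>R g"
    by (simp add: g_def matrix_vector_right_distrib cancel matrix_vector_mult_scaleR
        algebra_simps)
  have l: "l * (b \<bullet> g) = b \<bullet> u - s"
    using con by (simp add: v inner_diff_right)
  have "a \<bullet> g = \<alpha> * (b \<bullet> g)"
    using schur by (simp add: \<alpha> g_def)
  then have "a \<bullet> v = a \<bullet> u - \<alpha> * (l * (b \<bullet> g))"
    by (simp add: v inner_diff_right mult_ac)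
  then show ?thesis
    by (simp add: l inner_diff_left algebra_simps)
qed

lemma pos_def_imp_invertible:
  fixes A :: "real ^ 'n::finite ^ 'n"
  assumes "\<And>w. w \<noteq> 0 \<Longrightarrow> w \<bullet> (A *v w) > 0"
  shows "invertible A"
proof -
  have "w = 0" if "A *v w = 0" for w
    using assms[of w] that by force
  then show ?thesis
    using matrix_left_invertible_ker invertible_left_inverse by blast
qed

text \<open>With \<open>g = A\<inverse> b\<close> this is the form \<open>g \<bullet> A g\<close>.\<close>

lemma pos_def_inverse_form_pos:
  fixes A :: "real ^ 'n::finite ^ 'n"
  assumes pos: "\<And>w. w \<noteq> 0 \<Longrightarrow> w \<bullet> (A *v w) > 0" and b: "b \<noteq> 0"
  shows "b \<bullet> (matrix_inv A *v b) > 0"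
proof -
  define g where "g = matrix_inv A *v b"
  have Ag: "A *v g = b"
    using pos_def_imp_invertible[OF pos]
    by (simp add: g_def matrix_vector_mul_assoc matrix_inv(1))
  then have "g \<noteq> 0"
    using b by auto
  then show ?thesis
    using pos[of g] by (simp add: Ag inner_commute flip: g_def)
qed

section \<open>The polynomial correction\<close>

theorem proposition3:
  fixes p :: nat
    and \<Omega> \<Omega>h T :: "(real ^ 'd::finite) set"
    and \<T> :: "(real ^ 'd) set set"
    and \<M> :: "real ^ 'd \<Rightarrow> real ^ 'd"
    and uD uh vh :: "real ^ 'd \<Rightarrow> real"
    and \<psi> :: "'n::finite \<Rightarrow> real ^ 'd \<Rightarrow> real"
    and \<phi> :: "real ^ 'd \<Rightarrow> real ^ 'n"
    and M :: "real ^ 'n ^ 'n"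
    and u v :: "real ^ 'n"
    and lam \<alpha> :: real
    and xt xb :: "real ^ 'd"
  assumes "simplicial_mesh \<T>" and "\<Omega>h = \<Union>\<T>"
    and "boundary_element \<T> T"
    and "\<M> \<in> frontier \<Omega>h \<rightarrow> frontier \<Omega>"
    and "real CARD('n) = (\<Prod>l=1..CARD('d). (real p + real l) / real l)"
    and "indexed_basis \<psi> (poly_space p)"
    and "\<phi> = basis_vec \<psi>"
    and "M = mass_matrix T \<psi>"
    and "uh = (\<lambda>x. \<phi> x \<bullet> u)"
    and "xt \<in> frontier \<Omega>h" and "xb = \<M> xt"
    and "bordered_matrix M (\<phi> xb) *v bordered_vec v lam = bordered_vec (M *v u) (uD xb)"
    and "vh = (\<lambda>x. \<phi> x \<bullet> v)"
    and "\<alpha> = (\<phi> xt \<bullet> (matrix_inv M *v \<phi> xb)) / (\<phi> xb \<bullet> (matrix_inv M *v \<phi> xb))"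
  shows "vh xt = (\<phi> xt - \<alpha> *\<^sub>R \<phi> xb) \<bullet> u + \<alpha> * uD xb"
proof -
  have "int DIM(real ^ 'd) simplex T"
    using assms(1,3) by (simp add: simplicial_mesh_def boundary_element_def)
  then have T: "compact T" "interior T \<noteq> {}"
    by (rule compact_simplex, rule interior_simplex_nonempty_full_dim)
  have pos: "w \<bullet> (M *v w) > 0" if "w \<noteq> 0" for w
    using mass_matrix_pos_def[OF assms(6) T that] by (simp add: assms(8))
  have "\<phi> xb \<noteq> 0"
    using basis_vec_poly_space_nonzero[OF assms(6)] by (simp add: assms(7))
  then have "\<phi> xb \<bullet> (matrix_inv M *v \<phi> xb) > 0"
    by (intro pos_def_inverse_form_pos pos)
  then show ?thesis
    using bordered_system_solution[OF pos_def_imp_invertible[OF pos] _ assms(12,14)]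
    by (simp add: assms(13))
qed

end
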